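(* Let $f_1,\dots,f_K:\mathbb{R}^N\to[0,\infty)$ be convex, continuous functions, let $C\subset\mathbb{R}^N$ be a nonempty, closed, convex set, and let $f:=\sum_{i=1}^K f_i$. Assume: (1) for each $i=1,\dots,K$ there exists $M_i\in(0,\infty)$ such that $\|g\|\le M_i$ for all $x\in C$ and all $g\in\partial f_i(x)$; (2) $\operatorname{argmin}_{x\in C}f(x)\neq\emptyset$; (3) the step-ranges $[\underline{\lambda}_n,\overline{\lambda}_n]\subset(0,\infty)$ $(n\in\mathbb{N})$ satisfy $$\sum_{n=1}^\infty\overline{\lambda}_n=\infty,\quad \sum_{n=1}^\infty\overline{\lambda}_n^2<\infty,\quad \lim_{n\to\infty}\frac{\underline{\lambda}_n}{\overline{\lambda}_n}=1,\quad \sum_{n=1}^\infty(\overline{\lambda}_n-\underline{\lambda}_n)<\infty.$$ Let $\{x_n\}$ be any sequence generated by the incremental subgradient algorithm or by the parallel subgradient algorithm (both described in the context) with these step-ranges. Then $\{x_n\}$ converges to an optimal solution of the problem of minimizing $f$ over $C$, i.e. to a point of $\operatorname{argmin}_{x\in C}f(x)$.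
   Context: $\mathbb{R}^N$ carries the standard Euclidean inner product $\langle\cdot,\cdot\rangle$ and norm $\|\cdot\|$; $\mathbb{N}=\{1,2,\dots\}$. For a convex $h:\mathbb{R}^N\to\mathbb{R}$, $\partial h(x)$ is the set of $g\in\mathbb{R}^N$ with $h(x)+\langle y-x,g\rangle\le h(y)$ for all $y\in\mathbb{R}^N$. $P_C$ is the metric projection onto $C$. Incremental subgradient algorithm: choose $x_1\in C$. For each $n\in\mathbb{N}$, set $y_{n,0}:=x_n$; for $i=1,2,\dots,K$ in sequence, choose any $g_{n,i}\in\partial f_i(y_{n,i-1})$, choose any $\lambda_{n,i}\in[\underline{\lambda}_n,\overline{\lambda}_n]$ (e.g. by a line search), and set $y_{n,i}:=P_C(y_{n,i-1}-\lambda_{n,i}g_{n,i})$; then set $x_{n+1}:=y_{n,K}$. Parallel subgradient algorithm: choose $x_1\in C$. For each $n\in\mathbb{N}$ and each $i\in\{1,\dots,K\}$ independently, choose any $g_{n,i}\in\partial f_i(x_n)$, choose any $\lambda_{n,i}\in[\underline{\lambda}_n,\overline{\lambda}_n]$ (e.g. by a line search), and set $y_{n,i}:=P_C(x_n-\lambda_{n,i}g_{n,i})$; then set $x_{n+1}:=\frac1K\sum_{i=1}^K y_{n,i}$. *)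

theory Defs
  imports "HOL-Analysis.Analysis"
begin

definition subdifferential :: "('a::euclidean_space \<Rightarrow> real) \<Rightarrow> 'a \<Rightarrow> 'a set" where
  "subdifferential h x = {g. \<forall>y. h x + (y - x) \<bullet> g \<le> h y}"

definition argmin_set :: "('a \<Rightarrow> real) \<Rightarrow> 'a set \<Rightarrow> 'a set" where
  "argmin_set h C = {x. is_arg_min h (\<lambda>z. z \<in> C) x}"

text \<open>
  In both algorithms the iterations are numbered from \<open>n = 1\<close> and the functions are
  \<open>f 1, \<dots>, f K\<close>; values of the sequences at index \<open>0\<close> (other than the inner
  starting point \<open>y n 0\<close>) play no role. The step ranges are \<open>{lo n..hi n}\<close>, and
  \<^const>\<open>closest_point\<close> is the metric projection when \<open>C\<close> is nonempty,
  closed and convex. The predicates state that \<open>x\<close> is a possible outcome for some choice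
  of subgradients \<open>g\<close> and step sizes \<open>lam\<close>.
\<close>

definition incremental_subgradient_seq ::
  "(nat \<Rightarrow> 'a::euclidean_space \<Rightarrow> real) \<Rightarrow> nat \<Rightarrow> 'a set \<Rightarrow> (nat \<Rightarrow> real) \<Rightarrow> (nat \<Rightarrow> real)
    \<Rightarrow> (nat \<Rightarrow> 'a) \<Rightarrow> bool" where
  "incremental_subgradient_seq f K C lo hi x \<longleftrightarrow>
     x 1 \<in> C \<and>
     (\<exists>(y :: nat \<Rightarrow> nat \<Rightarrow> 'a) (g :: nat \<Rightarrow> nat \<Rightarrow> 'a) (lam :: nat \<Rightarrow> nat \<Rightarrow> real).
        \<forall>n\<ge>1.
          y n 0 = x n \<and>
          (\<forall>i\<in>{1..K}.
             g n i \<in> subdifferential (f i) (y n (i - 1)) \<and>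
             lam n i \<in> {lo n..hi n} \<and>
             y n i = closest_point C (y n (i - 1) - lam n i *\<^sub>R g n i)) \<and>
          x (n + 1) = y n K)"

definition parallel_subgradient_seq ::
  "(nat \<Rightarrow> 'a::euclidean_space \<Rightarrow> real) \<Rightarrow> nat \<Rightarrow> 'a set \<Rightarrow> (nat \<Rightarrow> real) \<Rightarrow> (nat \<Rightarrow> real)
    \<Rightarrow> (nat \<Rightarrow> 'a) \<Rightarrow> bool" where
  "parallel_subgradient_seq f K C lo hi x \<longleftrightarrow>
     x 1 \<in> C \<and>
     (\<exists>(y :: nat \<Rightarrow> nat \<Rightarrow> 'a) (g :: nat \<Rightarrow> nat \<Rightarrow> 'a) (lam :: nat \<Rightarrow> nat \<Rightarrow> real).
        \<forall>n\<ge>1.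
          (\<forall>i\<in>{1..K}.
             g n i \<in> subdifferential (f i) (x n) \<and>
             lam n i \<in> {lo n..hi n} \<and>
             y n i = closest_point C (x n - lam n i *\<^sub>R g n i)) \<and>
          x (n + 1) = (1 / real K) *\<^sub>R (\<Sum>i=1..K. y n i))"

end

theory Submission
  imports Defs
begin

text \<open>
  Both algorithms are quasi-Fejer monotone with respect to the minimizers. Write
  \<open>F\<close> for the sum of the \<open>f i\<close>. A projected subgradient step for one
  \<open>f i\<close> satisfies the classical inequality in which the squared distance to a
  comparison point \<open>z \<in> C\<close> drops by about twice the step size times
  \<open>f i y - f i z\<close>. Adding these inequalities over \<open>i\<close> should produce the
  gap \<open>F (x n) - F z\<close>, but two things stand in the way.

  First, the step sizes differ from one \<open>i\<close> to another, so the weighted gaps do not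
  add up to a multiple of the gap of \<open>F\<close>. Since every \<open>f i\<close> is nonnegative, one
  may use the smallest step size \<open>lo n\<close> in front of \<open>f i (x n)\<close> and the largest
  one \<open>hi n\<close> in front of \<open>f i z\<close>. The price is the term
  \<open>(hi n - lo n) * F z\<close>, which is summable.

  Second, the incremental algorithm takes its subgradient of \<open>f i\<close> at an intermediate point, not
  at \<open>x n\<close>. Within one pass the iterates move by \<open>O (hi n)\<close>, and \<open>f i\<close> is
  Lipschitz on \<open>C\<close>: it has a subgradient everywhere
  (\<open>subdifferential_nonempty\<close>) and subgradients on \<open>C\<close> are bounded. Multiplied
  by the step size, the error is \<open>O ((hi n)\<^sup>2)\<close>, again summable.

  Hence \<open>incremental_pass_estimate\<close> and \<open>parallel_pass_estimate\<close> yield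
  inequalities of the same form, with different constants \<open>\<alpha> > 0\<close> and
  \<open>\<beta> \<ge> 0\<close>:
  \<open>\<parallel>x (n + 1) - z\<parallel>\<^sup>2 \<le> \<parallel>x n - z\<parallel>\<^sup>2 - \<alpha> * lo n * (F (x n) - F z) + \<alpha> * (hi n - lo n) * F z + \<beta> * (hi n)\<^sup>2\<close>.
  The step sizes \<open>lo n\<close> are not summable, because the \<open>hi n\<close> are not and the
  differences are. Then \<open>quasi_Fejer_minimizing_sequence_converges\<close> gives the result: the
  distance to each minimizer converges, the gap gets arbitrarily small along a
  subsequence, so some minimizer is a cluster point, and the distance to it converges to
  zero.
\<close>

section \<open>Subgradients of finite convex functions\<close>

text \<open>
  A hyperplane separating the epigraph of \<open>h\<close> from the open ray below
  \<open>(x, h x)\<close> supports the epigraph at that point. As \<open>h\<close> is finite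
  everywhere, it cannot be vertical, so its slope is a subgradient.
\<close>

lemma subdifferential_nonempty:
  fixes h :: "'a::euclidean_space \<Rightarrow> real"
  assumes "convex_on UNIV h"
  shows "subdifferential h x \<noteq> {}"
proof -
  let ?E = "epigraph UNIV h" and ?R = "{x} \<times> {..<h x}"
  have "convex ?E"
    using assms by (simp add: convex_epigraph)
  moreover have "convex ?R"
    by (intro convex_Times) auto
  moreover have "(x, h x) \<in> ?E" "(x, h x - 1) \<in> ?R"
    by (auto simp: epigraph_def)
  moreover have "?R \<inter> ?E = {}"
    by (auto simp: epigraph_def)
  ultimately obtain a b where "a \<noteq> 0"
    and R: "\<forall>v\<in>?R. a \<bullet> v \<le> b" and E: "\<forall>v\<in>?E. b \<le> a \<bullet> v"
    using separating_hyperplane_sets[of ?R ?E] by blast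
  obtain c s where a: "a = (c, s)" by fastforce
  have below: "c \<bullet> x + s * t \<le> b" if "t < h x" for t
    using R[rule_format, of "(x, t)"] that by (simp add: a)
  have above: "b \<le> c \<bullet> y + s * t" if "h y \<le> t" for y t
    using E[rule_format, of "(y, t)"] that by (simp add: a epigraph_def)
  \<comment> \<open>\<open>s\<close> is the component of the normal vector in the direction of the values of \<open>h\<close>.\<close>
  have "0 \<le> s"
    using below[of "h x - 1"] above[of x "h x"] by (simp add: algebra_simps)
  have touch: "c \<bullet> x + s * h x \<le> b"
  proof (rule field_le_epsilon)
    fix e :: real assume "0 < e"
    then have "0 < e / (s + 1)" "s * (e / (s + 1)) \<le> e"
      using \<open>0 \<le> s\<close> by (auto simp: field_simps)
    then show "c \<bullet> x + s * h x \<le> b + e"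
      using below[of "h x - e / (s + 1)"] by (simp add: right_diff_distrib)
  qed
  have "s \<noteq> 0"
  proof
    assume "s = 0"
    then have "c \<bullet> c \<le> 0"
      using touch above[of "x - c" "h (x - c)"] by (simp add: inner_diff_right)
    then show False
      using \<open>a \<noteq> 0\<close> \<open>s = 0\<close> inner_gt_zero_iff[of c] by (auto simp: a zero_prod_def simp del: inner_gt_zero_iff)
  qed
  then have "0 < s" using \<open>0 \<le> s\<close> by simp
  have "- (c /\<^sub>R s) \<in> subdifferential h x"
    unfolding subdifferential_def
  proof (clarify)
    fix y
    have "s * h x - c \<bullet> (y - x) \<le> s * h y"
      using touch above[of y "h y"] by (simp add: inner_diff_right)
    then show "h x + (y - x) \<bullet> - (c /\<^sub>R s) \<le> h y"
      using \<open>0 < s\<close> by (simp add: field_simps inner_commute)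
  qed
  then show ?thesis by blast
qed

section \<open>Descent towards a point of the constraint set\<close>

text \<open>
  Nonexpansiveness of the projection and the subgradient inequality at \<open>y\<close> give the
  usual estimate with \<open>s * (h y - h z)\<close>. It is stated with \<open>h x\<close> instead of
  \<open>h y\<close>, where \<open>x\<close> is the point at which the outer iteration started, and with
  the bounds \<open>l\<close> and \<open>u\<close> instead of \<open>s\<close>, so that the right-hand sides
  for different functions and step sizes can be added. The case \<open>x = y\<close>,
  \<open>D = 0\<close> serves the parallel algorithm.
\<close>

lemma projected_subgradient_step:
  fixes h :: "'a::euclidean_space \<Rightarrow> real"
  assumes C: "closed C" "convex C" "x \<in> C" "y \<in> C" "z \<in> C"
    and h: "convex_on UNIV h" "\<And>v. 0 \<le> h v"
    and M: "\<And>v k. v \<in> C \<Longrightarrow> k \<in> subdifferential h v \<Longrightarrow> norm k \<le> M"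
    and g: "g \<in> subdifferential h y"
    and s: "0 < l" "s \<in> {l..u}"
    and D: "norm (y - x) \<le> D"
  shows "(norm (closest_point C (y - s *\<^sub>R g) - z))\<^sup>2
    \<le> (norm (y - z))\<^sup>2 - 2 * l * h x + 2 * u * h z + (M * u)\<^sup>2 + 2 * M * u * D"
proof -
  obtain k where k: "k \<in> subdifferential h x"
    using subdifferential_nonempty[OF h(1)] by blast
  have "norm g \<le> M" "norm k \<le> M"
    using M g k C by auto
  have "0 \<le> M" "0 \<le> D" "0 \<le> s" "s \<le> u"
    using order_trans[OF norm_ge_zero \<open>norm g \<le> M\<close>] order_trans[OF norm_ge_zero D] s by auto
  have "norm (closest_point C (y - s *\<^sub>R g) - z) \<le> norm (y - s *\<^sub>R g - z)"
    using closest_point_lipschitz[of C "y - s *\<^sub>R g" z] C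
    by (metis closest_point_self dist_norm empty_iff)
  then have "(norm (closest_point C (y - s *\<^sub>R g) - z))\<^sup>2 \<le> (norm (y - z - s *\<^sub>R g))\<^sup>2"
    by (simp add: algebra_simps)
  also have "\<dots> = (norm (y - z))\<^sup>2 - 2 * s * ((y - z) \<bullet> g) + (s * norm g)\<^sup>2"
    by (simp add: power2_norm_eq_inner algebra_simps inner_commute power_mult_distrib)
       (simp add: power2_eq_square)
  also have "\<dots> \<le> (norm (y - z))\<^sup>2 - 2 * l * h x + 2 * u * h z + 2 * M * u * D + (M * u)\<^sup>2"
  proof -
    have "h y - h z \<le> (y - z) \<bullet> g"
      using g by (auto simp: subdifferential_def inner_diff_left dest: spec[of _ z])
    then have 1: "s * (h y - h z) \<le> s * ((y - z) \<bullet> g)"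
      using \<open>0 \<le> s\<close> by (rule mult_left_mono)
    \<comment> \<open>The subgradient \<open>k\<close> at \<open>x\<close> controls how far \<open>h y\<close> can lie below \<open>h x\<close>.\<close>
    have "\<bar>(y - x) \<bullet> k\<bar> \<le> D * M"
      using Cauchy_Schwarz_ineq2[of "y - x" k] D \<open>norm k \<le> M\<close> \<open>0 \<le> D\<close>
      by (meson mult_mono norm_ge_zero order_trans)
    moreover have "h x + (y - x) \<bullet> k \<le> h y"
      using k by (auto simp: subdifferential_def)
    ultimately have "h x - M * D \<le> h y"
      by (simp add: mult.commute)
    then have 2: "s * h x - s * (M * D) \<le> s * h y"
      using \<open>0 \<le> s\<close> by (metis mult_left_mono right_diff_distrib)
    \<comment> \<open>Nonnegativity of \<open>h\<close> allows the passage from \<open>s\<close> to the two bounds.\<close>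
    have 3: "s * (M * D) \<le> u * (M * D)" "l * h x \<le> s * h x" "s * h z \<le> u * h z"
      using s h \<open>0 \<le> M\<close> \<open>0 \<le> D\<close> by (auto intro!: mult_right_mono)
    have 4: "(s * norm g)\<^sup>2 \<le> (M * u)\<^sup>2"
      using mult_mono[OF \<open>s \<le> u\<close> \<open>norm g \<le> M\<close>] \<open>0 \<le> s\<close> \<open>s \<le> u\<close>
      by (intro power_mono) (auto simp: mult.commute)
    show ?thesis
      using 1 2 3 4 by (simp add: algebra_simps)
  qed
  finally show ?thesis by simp
qed

text \<open>
  Each inner step moves by at most \<open>M * u\<close>, since the projection fixes
  \<open>y (i - 1) \<in> C\<close>. So throughout the pass the distance to \<open>x\<close> is at most
  \<open>K * (M * u)\<close>, and with this value of \<open>D\<close> every step contributes the same error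
  \<open>(1 + 2 * K) * (M * u)\<^sup>2\<close>.
\<close>

lemma incremental_pass_estimate:
  fixes f :: "nat \<Rightarrow> 'a::euclidean_space \<Rightarrow> real"
  assumes C: "closed C" "convex C" "x \<in> C" "z \<in> C"
    and f: "\<And>i. i \<in> {1..K} \<Longrightarrow> convex_on UNIV (f i)" "\<And>i v. i \<in> {1..K} \<Longrightarrow> 0 \<le> f i v"
    and M: "\<And>i v k. i \<in> {1..K} \<Longrightarrow> v \<in> C \<Longrightarrow> k \<in> subdifferential (f i) v \<Longrightarrow> norm k \<le> M"
    and l: "0 < l"
    and y0: "y 0 = x"
    and y: "\<And>i. i \<in> {1..K} \<Longrightarrow> g i \<in> subdifferential (f i) (y (i - 1)) \<and> s i \<in> {l..u} \<and>
               y i = closest_point C (y (i - 1) - s i *\<^sub>R g i)"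
  shows "i \<le> K \<Longrightarrow> y i \<in> C \<and> norm (y i - x) \<le> real i * (M * u) \<and>
    (norm (y i - z))\<^sup>2 \<le> (norm (x - z))\<^sup>2 - 2 * l * (\<Sum>j=1..i. f j x) + 2 * u * (\<Sum>j=1..i. f j z)
      + real i * ((1 + 2 * real K) * (M * u)\<^sup>2)"
proof (induction i)
  case 0
  then show ?case using C y0 by simp
next
  case (Suc i)
  let ?i = "Suc i"
  have i: "?i \<in> {1..K}" using Suc.prems by simp
  have IH: "y i \<in> C" "norm (y i - x) \<le> real i * (M * u)"
    and est: "(norm (y i - z))\<^sup>2 \<le> (norm (x - z))\<^sup>2 - 2 * l * (\<Sum>j=1..i. f j x)
      + 2 * u * (\<Sum>j=1..i. f j z) + real i * ((1 + 2 * real K) * (M * u)\<^sup>2)"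
    using Suc by auto
  have g: "g ?i \<in> subdifferential (f ?i) (y i)" and s: "s ?i \<in> {l..u}"
    and eq: "y ?i = closest_point C (y i - s ?i *\<^sub>R g ?i)"
    using y[OF i] by auto
  have "norm (g ?i) \<le> M" using M[OF i IH(1) g] .
  then have "0 \<le> M" using norm_ge_zero order_trans by blast
  have "0 \<le> u" using s l by auto
  have "y ?i \<in> C"
    unfolding eq using C by (intro closest_point_in_set) auto
  moreover have "norm (y ?i - x) \<le> real ?i * (M * u)"
  proof -
    have "dist (y ?i) (closest_point C (y i)) \<le> dist (y i - s ?i *\<^sub>R g ?i) (y i)"
      unfolding eq using C by (intro closest_point_lipschitz) auto
    then have "norm (y ?i - y i) \<le> s ?i * norm (g ?i)"
      using IH(1) s l by (simp add: closest_point_self dist_norm)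
    also have "\<dots> \<le> u * M"
      using s l \<open>norm (g ?i) \<le> M\<close> by (intro mult_mono) auto
    finally show ?thesis
      using norm_triangle_ineq[of "y ?i - y i" "y i - x"] IH(2) by (simp add: algebra_simps)
  qed
  moreover have "(norm (y ?i - z))\<^sup>2 \<le> (norm (y i - z))\<^sup>2 - 2 * l * f ?i x + 2 * u * f ?i z
      + (1 + 2 * real K) * (M * u)\<^sup>2"
  proof -
    have "real i * (M * u) \<le> real K * (M * u)"
      using Suc.prems \<open>0 \<le> M\<close> \<open>0 \<le> u\<close> by (intro mult_right_mono) auto
    then have "norm (y i - x) \<le> real K * (M * u)"
      using IH(2) by linarith
    from projected_subgradient_step[OF C(1,2,3) IH(1) C(4) f(1)[OF i] f(2)[OF i] M[OF i] g l s this]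
    show ?thesis
      unfolding eq by (simp add: algebra_simps power2_eq_square)
  qed
  ultimately show ?case
    using est by (simp add: algebra_simps)
qed

text \<open>
  The squared norm is convex, so the squared distance from the average to \<open>z\<close> is at most
  the average of the squared distances, each of which is bounded by a single step from
  \<open>x\<close>.
\<close>

lemma parallel_pass_estimate:
  fixes f :: "nat \<Rightarrow> 'a::euclidean_space \<Rightarrow> real"
  assumes K: "1 \<le> K"
    and C: "closed C" "convex C" "x \<in> C" "z \<in> C"
    and f: "\<And>i. i \<in> {1..K} \<Longrightarrow> convex_on UNIV (f i)" "\<And>i v. i \<in> {1..K} \<Longrightarrow> 0 \<le> f i v"
    and M: "\<And>i v k. i \<in> {1..K} \<Longrightarrow> v \<in> C \<Longrightarrow> k \<in> subdifferential (f i) v \<Longrightarrow> norm k \<le> M"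
    and l: "0 < l"
    and y: "\<And>i. i \<in> {1..K} \<Longrightarrow> g i \<in> subdifferential (f i) x \<and> s i \<in> {l..u} \<and>
               y i = closest_point C (x - s i *\<^sub>R g i)"
  shows "(1 / real K) *\<^sub>R (\<Sum>i=1..K. y i) \<in> C"
    and "(norm ((1 / real K) *\<^sub>R (\<Sum>i=1..K. y i) - z))\<^sup>2 \<le> (norm (x - z))\<^sup>2
      - 2 / real K * l * (\<Sum>i=1..K. f i x) + 2 / real K * u * (\<Sum>i=1..K. f i z) + (M * u)\<^sup>2"
proof -
  have K0: "0 < real K" using K by simp
  have "y i \<in> C" if "i \<in> {1..K}" for i
    using y[OF that] C by (auto intro!: closest_point_in_set)
  then have "(\<Sum>i=1..K. (1 / real K) *\<^sub>R y i) \<in> C"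
    using C K by (intro convex_sum) auto
  then show "(1 / real K) *\<^sub>R (\<Sum>i=1..K. y i) \<in> C"
    by (simp add: scaleR_sum_right)
  have "(1 / real K) *\<^sub>R (\<Sum>i=1..K. y i) - z = (1 / real K) *\<^sub>R (\<Sum>i=1..K. y i - z)"
    using K0 by (simp add: sum_subtractf scaleR_diff_right sum_constant_scaleR)
  then have "(norm ((1 / real K) *\<^sub>R (\<Sum>i=1..K. y i) - z))\<^sup>2
      = (norm (\<Sum>i=1..K. y i - z))\<^sup>2 / (real K)\<^sup>2"
    by (simp add: power_divide)
  also have "\<dots> \<le> (\<Sum>i=1..K. norm (y i - z))\<^sup>2 / (real K)\<^sup>2"
    by (intro divide_right_mono power_mono norm_sum) auto
  also have "\<dots> \<le> ((\<Sum>i=1..K. (norm (y i - z))\<^sup>2) * real K) / (real K)\<^sup>2"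
    using sum_squared_le_sum_of_squares[of "\<lambda>i. norm (y i - z)" "{1..K}"]
    by (intro divide_right_mono) auto
  also have "\<dots> = (\<Sum>i=1..K. (norm (y i - z))\<^sup>2) / real K"
    using K0 by (simp add: power2_eq_square)
  also have "\<dots> \<le> (\<Sum>i=1..K. (norm (x - z))\<^sup>2 - 2 * l * f i x + 2 * u * f i z + (M * u)\<^sup>2) / real K"
  proof (intro divide_right_mono sum_mono)
    fix i assume i: "i \<in> {1..K}"
    have "(norm (closest_point C (x - s i *\<^sub>R g i) - z))\<^sup>2
        \<le> (norm (x - z))\<^sup>2 - 2 * l * f i x + 2 * u * f i z + (M * u)\<^sup>2 + 2 * M * u * 0"
      by (rule projected_subgradient_step[OF C(1,2,3,3,4) f(1)[OF i] f(2)[OF i] M[OF i] _ l])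
        (use y[OF i] in auto)
    then show "(norm (y i - z))\<^sup>2 \<le> (norm (x - z))\<^sup>2 - 2 * l * f i x + 2 * u * f i z + (M * u)\<^sup>2"
      using y[OF i] by simp
  qed auto
  also have "\<dots> = (norm (x - z))\<^sup>2 - 2 / real K * l * (\<Sum>i=1..K. f i x)
      + 2 / real K * u * (\<Sum>i=1..K. f i z) + (M * u)\<^sup>2"
    using K0 by (simp add: sum.distrib sum_subtractf sum_distrib_left[symmetric] field_simps)
  finally show "(norm ((1 / real K) *\<^sub>R (\<Sum>i=1..K. y i) - z))\<^sup>2 \<le> (norm (x - z))\<^sup>2
      - 2 / real K * l * (\<Sum>i=1..K. f i x) + 2 / real K * u * (\<Sum>i=1..K. f i z) + (M * u)\<^sup>2" .
qed

section \<open>Convergence of quasi-Fejer monotone sequences\<close>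

text \<open>
  Subtracting the accumulated errors from \<open>a\<close> leaves a decreasing sequence that is bounded
  below by \<open>- suminf e\<close>. The total decrease \<open>b\<close> is paid for by \<open>a 0\<close> and
  the errors.
\<close>

lemma almost_decreasing_convergent:
  fixes a b e :: "nat \<Rightarrow> real"
  assumes a: "\<And>n. 0 \<le> a n" and b: "\<And>n. 0 \<le> b n" and e: "\<And>n. 0 \<le> e n" "summable e"
    and step: "\<And>n. a (Suc n) \<le> a n - b n + e n"
  shows "convergent a" and "summable b"
proof -
  have le: "(\<Sum>k<n. e k) \<le> suminf e" for n
    using e by (intro sum_le_suminf) auto
  have "decseq (\<lambda>n. a n - (\<Sum>k<n. e k))"
  proof (rule decseq_SucI)
    show "a (Suc n) - (\<Sum>k<Suc n. e k) \<le> a n - (\<Sum>k<n. e k)" for n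
      using step[of n] b[of n] by simp
  qed
  moreover have "- suminf e \<le> a n - (\<Sum>k<n. e k)" for n
    using a[of n] le[of n] by simp
  ultimately obtain L where "(\<lambda>n. a n - (\<Sum>k<n. e k)) \<longlonglongrightarrow> L"
    by (blast elim: decseq_convergent[of "\<lambda>n. a n - (\<Sum>k<n. e k)" "- suminf e"])
  then have "convergent (\<lambda>n. a n - (\<Sum>k<n. e k))"
    by (rule convergentI)
  moreover have "convergent (\<lambda>n. \<Sum>k<n. e k)"
    using e(2) by (simp add: summable_iff_convergent)
  ultimately have "convergent (\<lambda>n. (a n - (\<Sum>k<n. e k)) + (\<Sum>k<n. e k))"
    by (rule convergent_add)
  then show "convergent a" by simp
  have acc: "a n + (\<Sum>k<n. b k) \<le> a 0 + (\<Sum>k<n. e k)" for n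
  proof (induction n)
    case (Suc n)
    then show ?case using step[of n] by simp
  qed simp
  show "summable b"
  proof (rule summableI_nonneg_bounded)
    show "(\<Sum>k<n. b k) \<le> a 0 + suminf e" for n
      using acc[of n] le[of n] a[of n] by linarith
  qed (rule b)
qed

text \<open>
  The weighted gaps are summable and the weights are not, so the gap has lower limit zero.
  As \<open>X\<close> is bounded, \<open>F\<close> is continuous and \<open>C\<close> is closed, \<open>X\<close>
  has a cluster point \<open>q\<close> that is a minimizer. The descent inequality can now be used for
  \<open>q\<close> itself: the distance from \<open>X n\<close> to \<open>q\<close> converges, and it tends to
  zero along a subsequence.
\<close>

lemma quasi_Fejer_minimizing_sequence_converges:
  fixes X :: "nat \<Rightarrow> 'a::euclidean_space"
  assumes "closed C" and F: "continuous_on C F" and X: "\<And>n. X n \<in> C"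
    and ne: "argmin_set F C \<noteq> {}"
    and w: "\<And>n. 0 \<le> w n" "\<not> summable w"
    and e: "\<And>p n. p \<in> argmin_set F C \<Longrightarrow> 0 \<le> e p n"
      "\<And>p. p \<in> argmin_set F C \<Longrightarrow> summable (e p)"
    and step: "\<And>p n. p \<in> argmin_set F C \<Longrightarrow>
      (norm (X (Suc n) - p))\<^sup>2 \<le> (norm (X n - p))\<^sup>2 - w n * (F (X n) - F p) + e p n"
  shows "\<exists>q\<in>argmin_set F C. X \<longlonglongrightarrow> q"
proof -
  have min: "F p \<le> F v" if "p \<in> argmin_set F C" "v \<in> C" for p v
    using that by (auto simp: argmin_set_def is_arg_min_def not_less)
  have fejer: "convergent (\<lambda>n. (norm (X n - p))\<^sup>2)" "summable (\<lambda>n. w n * (F (X n) - F p))"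
    if p: "p \<in> argmin_set F C" for p
  proof -
    have gap: "0 \<le> w n * (F (X n) - F p)" for n
      using w(1) min[OF p X] by simp
    show "convergent (\<lambda>n. (norm (X n - p))\<^sup>2)" "summable (\<lambda>n. w n * (F (X n) - F p))"
      using almost_decreasing_convergent[OF zero_le_power2 gap e(1)[OF p] e(2)[OF p] step[OF p]]
      by simp_all
  qed
  obtain p where p: "p \<in> argmin_set F C" using ne by blast
  have "\<exists>n\<ge>N. F (X n) - F p < d" if "0 < d" for N d
  proof (rule ccontr)
    assume "\<not> (\<exists>n\<ge>N. F (X n) - F p < d)"
    then have "w n * d \<le> w n * (F (X n) - F p)" if "N \<le> n" for n
      using that w(1) by (intro mult_left_mono) (auto simp: not_less)
    then have "summable (\<lambda>n. d * w n)"
      using fejer(2)[OF p] w(1) \<open>0 < d\<close>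
      by (intro summable_comparison_test'[of "\<lambda>n. w n * (F (X n) - F p)" N "\<lambda>n. d * w n"])
        (auto simp: mult.commute)
    then show False using w(2) \<open>0 < d\<close> by (simp add: summable_cmult_iff)
  qed
  then have "\<forall>m. \<exists>n\<ge>m. F (X n) - F p < inverse (real (Suc m))"
    by simp
  then obtain s where s: "\<And>m. m \<le> s m" "\<And>m. F (X (s m)) - F p < inverse (real (Suc m))"
    by metis
  have "bounded (range X)"
  proof -
    obtain B where "\<And>n. \<bar>(norm (X n - p))\<^sup>2\<bar> \<le> B"
      using convergent_imp_Bseq[OF fejer(1)[OF p]] by (auto simp: Bseq_def)
    then have "dist p (X n) \<le> sqrt B" for n
      by (intro real_le_rsqrt) (simp add: dist_norm norm_minus_commute)
    then show ?thesis
      unfolding bounded_def by blast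
  qed
  then have "bounded (range (X \<circ> s))"
    by (rule bounded_subset) auto
  then obtain q r where r: "strict_mono r" and lim: "((X \<circ> s) \<circ> r) \<longlonglongrightarrow> q"
    using bounded_imp_convergent_subsequence[of "X \<circ> s"] by blast
  have "q \<in> C"
    using closed_sequentially[OF \<open>closed C\<close> _ lim] X by auto
  have "(\<lambda>n. F (X (s (r n)))) \<longlonglongrightarrow> F q"
    using continuous_on_tendsto_compose[OF F lim \<open>q \<in> C\<close>] X by (simp add: o_def)
  moreover have "(\<lambda>n. F (X (s (r n)))) \<longlonglongrightarrow> F p"
  proof (rule tendsto_sandwich[OF _ _ tendsto_const[of "F p"]])
    show "(\<lambda>n. F p + inverse (real (Suc (r n)))) \<longlonglongrightarrow> F p"
      using tendsto_add[OF tendsto_const LIMSEQ_subseq_LIMSEQ[OF LIMSEQ_inverse_real_of_nat r], of "F p"]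
      by (simp add: o_def)
    show "\<forall>\<^sub>F n in sequentially. F (X (s (r n))) \<le> F p + inverse (real (Suc (r n)))"
      using s(2) by (intro always_eventually allI) (smt (verit))
  qed (use min[OF p X] in auto)
  ultimately have "F q = F p"
    by (rule LIMSEQ_unique)
  then have q: "q \<in> argmin_set F C"
    using p \<open>q \<in> C\<close> by (simp add: argmin_set_def is_arg_min_def)
  obtain L where L: "(\<lambda>n. (norm (X n - q))\<^sup>2) \<longlonglongrightarrow> L"
    using fejer(1)[OF q] by (auto simp: convergent_def)
  have "filterlim (\<lambda>n. s (r n)) at_top sequentially"
    using order_trans[OF seq_suble[OF r] s(1)]
    by (intro filterlim_at_top_mono[OF filterlim_ident] always_eventually allI)
  then have "(\<lambda>n. (norm (X (s (r n)) - q))\<^sup>2) \<longlonglongrightarrow> L"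
    using filterlim_compose[OF L] by blast
  moreover have "(\<lambda>n. (norm (X (s (r n)) - q))\<^sup>2) \<longlonglongrightarrow> (norm (q - q))\<^sup>2"
    using lim by (intro tendsto_intros) (simp add: o_def)
  ultimately have "L = (norm (q - q))\<^sup>2"
    by (rule LIMSEQ_unique)
  then have "(\<lambda>n. sqrt ((norm (X n - q))\<^sup>2)) \<longlonglongrightarrow> sqrt 0"
    using L by (intro tendsto_real_sqrt) simp
  then have "X \<longlonglongrightarrow> q"
    by (simp add: tendsto_norm_zero_iff LIM_zero_iff)
  then show ?thesis using q by blast
qed

section \<open>Convergence of the incremental and parallel algorithms\<close>

theorem theorem1:
  fixes f :: "nat \<Rightarrow> real ^ 'N \<Rightarrow> real"
    and K :: nat
    and C :: "(real ^ 'N) set"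
    and lo hi :: "nat \<Rightarrow> real"
    and x :: "nat \<Rightarrow> real ^ 'N"
  assumes "K \<ge> 1"
    and "\<And>i z. i \<in> {1..K} \<Longrightarrow> 0 \<le> f i z"
    and "\<And>i. i \<in> {1..K} \<Longrightarrow> convex_on UNIV (f i)"
    and "\<And>i. i \<in> {1..K} \<Longrightarrow> continuous_on UNIV (f i)"
    and "C \<noteq> {}" and "closed C" and "convex C"
    and "\<And>i. i \<in> {1..K} \<Longrightarrow>
           \<exists>M>0. \<forall>z\<in>C. \<forall>g\<in>subdifferential (f i) z. norm g \<le> M"
    and "argmin_set (\<lambda>z. \<Sum>i=1..K. f i z) C \<noteq> {}"
    and "\<And>n. n \<ge> 1 \<Longrightarrow> 0 < lo n \<and> lo n \<le> hi n"
    and "filterlim (\<lambda>m. \<Sum>n=1..m. hi n) at_top sequentially"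
    and "summable (\<lambda>n. (hi (Suc n))\<^sup>2)"
    and "(\<lambda>n. lo n / hi n) \<longlonglongrightarrow> 1"
    and "summable (\<lambda>n. hi (Suc n) - lo (Suc n))"
    and "incremental_subgradient_seq f K C lo hi x \<or> parallel_subgradient_seq f K C lo hi x"
  shows "\<exists>p \<in> argmin_set (\<lambda>z. \<Sum>i=1..K. f i z) C. x \<longlonglongrightarrow> p"
proof -
  note f = assms(3,2)
  note C = assms(6,7)
  note steps = assms(10)
  let ?F = "\<lambda>z. \<Sum>i=1..K. f i z"
  obtain m where m: "\<And>i. i \<in> {1..K} \<Longrightarrow> 0 < m i"
    "\<And>i z g. i \<in> {1..K} \<Longrightarrow> z \<in> C \<Longrightarrow> g \<in> subdifferential (f i) z \<Longrightarrow> norm g \<le> m i"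
    using assms(8) by metis
  define M where "M = (\<Sum>i=1..K. m i)"
  have M: "norm g \<le> M" if "i \<in> {1..K}" "z \<in> C" "g \<in> subdifferential (f i) z" for i z g
  proof -
    have "m i \<le> M"
      unfolding M_def using that(1) m(1) by (intro member_le_sum) (auto simp: less_imp_le)
    then show ?thesis using m(2)[OF that] by linarith
  qed
  obtain \<alpha> \<beta> where "0 < \<alpha>" "0 \<le> \<beta>" and "x 1 \<in> C"
    and invariant: "\<And>n. 1 \<le> n \<Longrightarrow> x n \<in> C \<Longrightarrow> x (Suc n) \<in> C"
    and descent: "\<And>n z. 1 \<le> n \<Longrightarrow> x n \<in> C \<Longrightarrow> z \<in> C \<Longrightarrow> (norm (x (Suc n) - z))\<^sup>2
      \<le> (norm (x n - z))\<^sup>2 - \<alpha> * lo n * ?F (x n) + \<alpha> * hi n * ?F z + \<beta> * (hi n)\<^sup>2"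
    using assms(15)
  proof
    assume "incremental_subgradient_seq f K C lo hi x"
    then obtain y g s where "x 1 \<in> C" and run: "\<And>n. 1 \<le> n \<Longrightarrow> y n 0 = x n \<and>
        (\<forall>i\<in>{1..K}. g n i \<in> subdifferential (f i) (y n (i - 1)) \<and> s n i \<in> {lo n..hi n} \<and>
           y n i = closest_point C (y n (i - 1) - s n i *\<^sub>R g n i)) \<and> x (n + 1) = y n K"
      unfolding incremental_subgradient_seq_def by metis
    have pass: "x (Suc n) \<in> C" "(norm (x (Suc n) - z))\<^sup>2
      \<le> (norm (x n - z))\<^sup>2 - 2 * lo n * ?F (x n) + 2 * hi n * ?F z
        + real K * (1 + 2 * real K) * M\<^sup>2 * (hi n)\<^sup>2"
      if "1 \<le> n" "x n \<in> C" "z \<in> C" for n z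
      using incremental_pass_estimate[where y = "y n" and g = "g n" and s = "s n" and l = "lo n"
            and u = "hi n" and i = K, OF C that(2,3) f M]
        run[OF that(1)] steps[OF that(1)]
      by (auto simp: power_mult_distrib mult.assoc)
    show thesis
      by (rule that[of 2 "real K * (1 + 2 * real K) * M\<^sup>2"])
        (use pass \<open>x 1 \<in> C\<close> in auto)
  next
    assume "parallel_subgradient_seq f K C lo hi x"
    then obtain y g s where "x 1 \<in> C" and run: "\<And>n. 1 \<le> n \<Longrightarrow>
        (\<forall>i\<in>{1..K}. g n i \<in> subdifferential (f i) (x n) \<and> s n i \<in> {lo n..hi n} \<and>
           y n i = closest_point C (x n - s n i *\<^sub>R g n i)) \<and>
        x (n + 1) = (1 / real K) *\<^sub>R (\<Sum>i=1..K. y n i)"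
      unfolding parallel_subgradient_seq_def by metis
    have pass: "x (Suc n) \<in> C" "(norm (x (Suc n) - z))\<^sup>2
      \<le> (norm (x n - z))\<^sup>2 - 2 / real K * lo n * ?F (x n) + 2 / real K * hi n * ?F z
        + M\<^sup>2 * (hi n)\<^sup>2"
      if "1 \<le> n" "x n \<in> C" "z \<in> C" for n z
      using parallel_pass_estimate[where y = "y n" and g = "g n" and s = "s n" and l = "lo n"
            and u = "hi n", OF assms(1) C that(2,3) f M]
        run[OF that(1)] steps[OF that(1)]
      by (auto simp: power_mult_distrib)
    show thesis
      by (rule that[of "2 / real K" "M\<^sup>2"])
        (use pass \<open>x 1 \<in> C\<close> assms(1) in auto)
  qed
  have "x (Suc n) \<in> C" for n
    by (induction n) (use \<open>x 1 \<in> C\<close> invariant in auto)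
  moreover have "continuous_on C ?F"
    using assms(4) by (intro continuous_on_sum) (blast intro: continuous_on_subset)
  moreover have "\<not> summable (\<lambda>n. \<alpha> * lo (Suc n))"
  proof
    assume "summable (\<lambda>n. \<alpha> * lo (Suc n))"
    then have "summable (\<lambda>n. lo (Suc n))"
      using \<open>0 < \<alpha>\<close> by (simp add: summable_cmult_iff)
    then have "summable (\<lambda>n. hi (Suc n))"
      using summable_add[OF assms(14)] by fastforce
    then have "(\<lambda>m. \<Sum>n<m. hi (Suc n)) \<longlonglongrightarrow> (\<Sum>n. hi (Suc n))"
      by (rule summable_LIMSEQ)
    moreover have "(\<lambda>m. \<Sum>n<m. hi (Suc n)) = (\<lambda>m. \<Sum>n=1..m. hi n)"
      by (simp add: sum.atLeast1_atMost_eq)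
    ultimately show False
      using assms(11) not_tendsto_and_filterlim_at_infinity[of sequentially]
        filterlim_at_top_imp_at_infinity trivial_limit_sequentially by metis
  qed
  \<comment> \<open>Rewriting \<open>hi * F p - lo * F (x n)\<close> as \<open>(hi - lo) * F p - lo * (F (x n) - F p)\<close>
    separates the error from the gap.\<close>
  moreover define e where "e p n = \<alpha> * ?F p * (hi (Suc n) - lo (Suc n)) + \<beta> * (hi (Suc n))\<^sup>2"
    for p n
  have "0 \<le> e p n" for p n
    unfolding e_def using \<open>0 < \<alpha>\<close> \<open>0 \<le> \<beta>\<close> steps[of "Suc n"] assms(2)
    by (intro add_nonneg_nonneg mult_nonneg_nonneg sum_nonneg) auto
  moreover have "summable (e p)" for p
    unfolding e_def using assms(12,14) by (intro summable_add summable_mult)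
  moreover have "(norm (x (Suc (Suc n)) - p))\<^sup>2
      \<le> (norm (x (Suc n) - p))\<^sup>2 - \<alpha> * lo (Suc n) * (?F (x (Suc n)) - ?F p) + e p n"
    if "p \<in> argmin_set ?F C" for p n
    using descent[of "Suc n" p] that \<open>\<And>n. x (Suc n) \<in> C\<close>
    by (simp add: e_def argmin_set_def is_arg_min_def algebra_simps)
  ultimately have "\<exists>p\<in>argmin_set ?F C. (\<lambda>n. x (Suc n)) \<longlonglongrightarrow> p"
    using assms(6,9) steps \<open>0 < \<alpha>\<close>
    by (intro quasi_Fejer_minimizing_sequence_converges[of C ?F "\<lambda>n. x (Suc n)" "\<lambda>n. \<alpha> * lo (Suc n)" e])
      (auto simp: less_imp_le)
  then show ?thesis
    by (simp add: filterlim_sequentially_Suc)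
qed

end
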